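(* The variety $\mathsf K$ of integral residuated lattices generated by all kites is generated by all finite-dimensional kites.
   Context: $\mathbb N=\{0,1,2,\dots\}$. A residuated lattice is an algebra $\mathbf G=(G;\wedge,\vee,\cdot,\backslash,/,e)$ such that $(G;\wedge,\vee)$ is a lattice, $(G;\cdot,e)$ is a monoid, and $x\cdot y\le z$ iff $y\le x\backslash z$ iff $x\le z/y$ for all $x,y,z\in G$. It is integral if $x\le e$ for all $x\in G$. The variety generated by a class of algebras is the least class containing it and closed under homomorphic images, subalgebras and direct products. A kite is any algebra $K^\lambda_{I_0,I_1}(\mathbf G)$, where $\mathbf G$ is an integral residuated lattice, $I_1\subseteq I_0$ are sets (possibly empty) and $\lambda\colon I_1\to I_0$ is injective; it is the following integral residuated lattice. For $n\ge1$ put $I_{n+1}=\{i\in I_n: \lambda(i)\in I_n\}$. Then $\lambda^{m-n}$ is a well-defined injective map $I_m\to I_n$ for $n\le m$; $\lambda^{-m}$ denotes the inverse of $\lambda^m$ on its image. The universe is the disjoint union $\biguplus_{n\in\mathbb N}G^{I_n}$ (different $n$ always give disjoint parts; if $I_n=\emptyset$, $G^{I_n}$ is a singleton), with elements written $\langle x_i: i\in I_n\rangle$. Order: $\langle x_i: i\in I_n\rangle\le\langle y_i: i\in I_m\rangle$ iff $m<n$, or $m=n$ and $x_i\le y_i$ for all $i\in I_n$. Unit: $1\in G^{I_0}$ with all coordinates $e$. Product: $\langle x_i: i\in I_m\rangle\cdot\langle y_i: i\in I_n\rangle=\langle x_{\lambda^n(i)}y_i: i\in I_{m+n}\rangle$.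 Right division: $\langle y_i: i\in I_n\rangle/\!/\langle x_i: i\in I_m\rangle$ is $1$ if $m>n$; if $m\le n$ it is the element of $G^{I_{n-m}}$ with $i$-th coordinate $y_{\lambda^{-m}(i)}/x_{\lambda^{-m}(i)}$ if $i\in\lambda^m(I_n)$ and $e$ otherwise. Left division: $\langle y_i: i\in I_n\rangle\backslash\!\backslash\langle x_i: i\in I_m\rangle$ is $1$ if $n>m$; if $n\le m$ it is the element of $G^{I_{m-n}}$ with $i$-th coordinate $y_{\lambda^{m-n}(i)}\backslash x_i$ if $i\in I_m$ and $e$ otherwise. A kite $K^\lambda_{I_0,I_1}(\mathbf G)$ is finite-dimensional if $I_0$ is a finite set. *)

theory Defs
  imports "HOL-Algebra.Group" "HOL-Library.FuncSet"
begin

section \<open>Residuated lattices\<close>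

record 'a rl = "'a monoid" +
  rl_meet :: "'a \<Rightarrow> 'a \<Rightarrow> 'a" (infixl "\<^bold>\<and>\<index>" 65)
  rl_join :: "'a \<Rightarrow> 'a \<Rightarrow> 'a" (infixl "\<^bold>\<or>\<index>" 65)
  rl_ldiv :: "'a \<Rightarrow> 'a \<Rightarrow> 'a"
  rl_rdiv :: "'a \<Rightarrow> 'a \<Rightarrow> 'a"

definition rl_le :: "('a, 'b) rl_scheme \<Rightarrow> 'a \<Rightarrow> 'a \<Rightarrow> bool" (infix "\<preceq>\<index>" 50)
  where "x \<preceq>\<^bsub>G\<^esub> y \<longleftrightarrow> x \<^bold>\<and>\<^bsub>G\<^esub> y = x"

locale residuated_lattice = monoid G for G :: "('a, 'b) rl_scheme" (structure) +
  assumes meet_closed: "x \<in> carrier G \<Longrightarrow> y \<in> carrier G \<Longrightarrow> x \<^bold>\<and> y \<in> carrier G"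
    and join_closed: "x \<in> carrier G \<Longrightarrow> y \<in> carrier G \<Longrightarrow> x \<^bold>\<or> y \<in> carrier G"
    and ldiv_closed: "x \<in> carrier G \<Longrightarrow> y \<in> carrier G \<Longrightarrow> rl_ldiv G x y \<in> carrier G"
    and rdiv_closed: "x \<in> carrier G \<Longrightarrow> y \<in> carrier G \<Longrightarrow> rl_rdiv G x y \<in> carrier G"
    and meet_comm: "x \<in> carrier G \<Longrightarrow> y \<in> carrier G \<Longrightarrow> x \<^bold>\<and> y = y \<^bold>\<and> x"
    and join_comm: "x \<in> carrier G \<Longrightarrow> y \<in> carrier G \<Longrightarrow> x \<^bold>\<or> y = y \<^bold>\<or> x"
    and meet_assoc: "x \<in> carrier G \<Longrightarrow> y \<in> carrier G \<Longrightarrow> z \<in> carrier G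
      \<Longrightarrow> (x \<^bold>\<and> y) \<^bold>\<and> z = x \<^bold>\<and> (y \<^bold>\<and> z)"
    and join_assoc: "x \<in> carrier G \<Longrightarrow> y \<in> carrier G \<Longrightarrow> z \<in> carrier G
      \<Longrightarrow> (x \<^bold>\<or> y) \<^bold>\<or> z = x \<^bold>\<or> (y \<^bold>\<or> z)"
    and meet_join_absorb: "x \<in> carrier G \<Longrightarrow> y \<in> carrier G \<Longrightarrow> x \<^bold>\<and> (x \<^bold>\<or> y) = x"
    and join_meet_absorb: "x \<in> carrier G \<Longrightarrow> y \<in> carrier G \<Longrightarrow> x \<^bold>\<or> (x \<^bold>\<and> y) = x"
    and ldiv_residual: "x \<in> carrier G \<Longrightarrow> y \<in> carrier G \<Longrightarrow> z \<in> carrier G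
      \<Longrightarrow> x \<otimes> y \<preceq> z \<longleftrightarrow> y \<preceq> rl_ldiv G x z"
    and rdiv_residual: "x \<in> carrier G \<Longrightarrow> y \<in> carrier G \<Longrightarrow> z \<in> carrier G
      \<Longrightarrow> x \<otimes> y \<preceq> z \<longleftrightarrow> x \<preceq> rl_rdiv G z y"

context residuated_lattice begin

lemma meet_idem: "x \<in> carrier G \<Longrightarrow> x \<^bold>\<and> x = x"
  by (metis join_meet_absorb meet_closed meet_join_absorb)

lemma join_idem: "x \<in> carrier G \<Longrightarrow> x \<^bold>\<or> x = x"
  by (metis join_meet_absorb join_closed meet_join_absorb)

lemma le_meet: "x \<in> carrier G \<Longrightarrow> y \<in> carrier G \<Longrightarrow> z \<in> carrier G
   \<Longrightarrow> z \<preceq> x \<^bold>\<and> y \<longleftrightarrow> z \<preceq> x \<and> z \<preceq> y"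
proof -
  assume c: "x \<in> carrier G" "y \<in> carrier G" "z \<in> carrier G"
  have "z \<^bold>\<and> x = z" if "z \<^bold>\<and> (x \<^bold>\<and> y) = z"
  proof -
    have "z \<^bold>\<and> x = (z \<^bold>\<and> (y \<^bold>\<and> x)) \<^bold>\<and> x" using that c by (simp add: meet_comm)
    also have "\<dots> = z \<^bold>\<and> (y \<^bold>\<and> (x \<^bold>\<and> x))" using c by (simp add: meet_assoc meet_closed)
    finally show ?thesis using that c by (simp add: meet_idem meet_comm)
  qed
  moreover have "z \<^bold>\<and> y = z" if "z \<^bold>\<and> (x \<^bold>\<and> y) = z"
  proof -
    have "z \<^bold>\<and> y = (z \<^bold>\<and> (x \<^bold>\<and> y)) \<^bold>\<and> y" using that by simp
    also have "\<dots> = z \<^bold>\<and> (x \<^bold>\<and> (y \<^bold>\<and> y))" using c by (simp add: meet_assoc meet_closed)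
    finally show ?thesis using that c by (simp add: meet_idem)
  qed
  ultimately show ?thesis using c by (auto simp: rl_le_def meet_assoc[symmetric])
qed

lemma le_iff_join: "x \<in> carrier G \<Longrightarrow> y \<in> carrier G \<Longrightarrow> x \<preceq> y \<longleftrightarrow> x \<^bold>\<or> y = y"
  unfolding rl_le_def by (metis join_comm join_meet_absorb meet_comm meet_join_absorb)

lemma le_join: "x \<in> carrier G \<Longrightarrow> y \<in> carrier G \<Longrightarrow> z \<in> carrier G
   \<Longrightarrow> x \<^bold>\<or> y \<preceq> z \<longleftrightarrow> x \<preceq> z \<and> y \<preceq> z"
proof -
  assume c: "x \<in> carrier G" "y \<in> carrier G" "z \<in> carrier G"
  have "x \<^bold>\<or> z = z" if "(x \<^bold>\<or> y) \<^bold>\<or> z = z"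
  proof -
    have "x \<^bold>\<or> z = x \<^bold>\<or> ((x \<^bold>\<or> y) \<^bold>\<or> z)" using that by simp
    also have "\<dots> = ((x \<^bold>\<or> x) \<^bold>\<or> y) \<^bold>\<or> z" using c by (simp add: join_assoc join_closed)
    finally show ?thesis using that c by (simp add: join_idem)
  qed
  moreover have "y \<^bold>\<or> z = z" if "(x \<^bold>\<or> y) \<^bold>\<or> z = z"
  proof -
    have "y \<^bold>\<or> z = y \<^bold>\<or> ((y \<^bold>\<or> x) \<^bold>\<or> z)" using that c by (simp add: join_comm)
    also have "\<dots> = ((y \<^bold>\<or> y) \<^bold>\<or> x) \<^bold>\<or> z" using c by (simp add: join_assoc join_closed)
    finally show ?thesis using that c by (simp add: join_idem join_comm)
  qed
  ultimately show ?thesis using c by (auto simp: le_iff_join join_closed join_assoc)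
qed

end

locale integral_residuated_lattice = residuated_lattice +
  assumes integral: "x \<in> carrier G \<Longrightarrow> x \<preceq> \<one>"


section \<open>Homomorphic images, subalgebras, products, varieties\<close>

definition rl_hom :: "'a rl \<Rightarrow> 'b rl \<Rightarrow> ('a \<Rightarrow> 'b) set"
  where "rl_hom A B = {h \<in> carrier A \<rightarrow> carrier B.
    h \<one>\<^bsub>A\<^esub> = \<one>\<^bsub>B\<^esub> \<and>
    (\<forall>x \<in> carrier A. \<forall>y \<in> carrier A.
       h (x \<otimes>\<^bsub>A\<^esub> y) = h x \<otimes>\<^bsub>B\<^esub> h y \<and>
       h (x \<^bold>\<and>\<^bsub>A\<^esub> y) = h x \<^bold>\<and>\<^bsub>B\<^esub> h y \<and>
       h (x \<^bold>\<or>\<^bsub>A\<^esub> y) = h x \<^bold>\<or>\<^bsub>B\<^esub> h y \<and>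
       h (rl_ldiv A x y) = rl_ldiv B (h x) (h y) \<and>
       h (rl_rdiv A x y) = rl_rdiv B (h x) (h y))}"

definition rl_subuniverse :: "'a set \<Rightarrow> 'a rl \<Rightarrow> bool"
  where "rl_subuniverse S A \<longleftrightarrow> S \<subseteq> carrier A \<and> \<one>\<^bsub>A\<^esub> \<in> S \<and>
    (\<forall>x \<in> S. \<forall>y \<in> S. x \<otimes>\<^bsub>A\<^esub> y \<in> S \<and> x \<^bold>\<and>\<^bsub>A\<^esub> y \<in> S \<and> x \<^bold>\<or>\<^bsub>A\<^esub> y \<in> S \<and>
       rl_ldiv A x y \<in> S \<and> rl_rdiv A x y \<in> S)"

definition rl_product :: "'j set \<Rightarrow> ('j \<Rightarrow> 'a rl) \<Rightarrow> ('j \<Rightarrow> 'a) rl"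
  where "rl_product J A =
    \<lparr>carrier = (\<Pi>\<^sub>E j\<in>J. carrier (A j)),
     mult = (\<lambda>x y. \<lambda>j\<in>J. x j \<otimes>\<^bsub>A j\<^esub> y j),
     one = (\<lambda>j\<in>J. \<one>\<^bsub>A j\<^esub>),
     rl_meet = (\<lambda>x y. \<lambda>j\<in>J. x j \<^bold>\<and>\<^bsub>A j\<^esub> y j),
     rl_join = (\<lambda>x y. \<lambda>j\<in>J. x j \<^bold>\<or>\<^bsub>A j\<^esub> y j),
     rl_ldiv = (\<lambda>x y. \<lambda>j\<in>J. rl_ldiv (A j) (x j) (y j)),
     rl_rdiv = (\<lambda>x y. \<lambda>j\<in>J. rl_rdiv (A j) (x j) (y j))\<rparr>"

definition hom_images :: "'a rl set \<Rightarrow> 'b rl set"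
  where "hom_images C = {B. \<exists>A \<in> C. \<exists>h \<in> rl_hom A B. h ` carrier A = carrier B}"

definition subalgebras :: "'a rl set \<Rightarrow> 'a rl set"
  where "subalgebras C = {A\<lparr>carrier := S\<rparr> | A S. A \<in> C \<and> rl_subuniverse S A}"

definition products :: "'a rl set \<Rightarrow> ('j \<Rightarrow> 'a) rl set"
  where "products C = {rl_product J A | J A. \<forall>j \<in> J. A j \<in> C}"

text \<open>A product of algebras over \<open>'a\<close> lives on another type, and in general does not fit into
  \<open>'a\<close> for cardinality reasons. So \<open>is_variety C\<close> describes the members over \<open>'a\<close> of a class that
  is closed under homomorphic images, subalgebras and products: every algebra over \<open>'a\<close> obtained
  from members of \<open>C\<close> by a product, a subalgebra of it and a homomorphic image of that is again in
  \<open>C\<close>; the intermediate algebras need not fit into \<open>'a\<close>. The index type chosen here is large enough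
  to give all algebras over \<open>'a\<close> that arise from products with arbitrary index sets
  (\<open>variety_closed_HSP\<close>). Closure under subalgebras and under homomorphic images alone
  (\<open>variety_closed_HS\<close>) is the case of a product of one factor.\<close>

definition is_variety :: "'a rl set \<Rightarrow> bool"
  where "is_variety C \<longleftrightarrow>
    hom_images (subalgebras (products C :: ('a rl \<times> ('a \<Rightarrow> 'a) \<Rightarrow> 'a) rl set)) \<subseteq> C"

lemma variety_closed_HSP:
  fixes C :: "'a rl set"
  assumes "is_variety C"
  shows "hom_images (subalgebras (products C :: ('j \<Rightarrow> 'a) rl set)) \<subseteq> C"
proof
  fix B :: "'a rl"
  assume "B \<in> hom_images (subalgebras (products C :: ('j \<Rightarrow> 'a) rl set))"
  then obtain J A S h where A: "\<And>j. j \<in> J \<Longrightarrow> A j \<in> C"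
    and S: "rl_subuniverse S (rl_product J A :: ('j \<Rightarrow> 'a) rl)"
    and h: "h \<in> rl_hom (rl_product J A\<lparr>carrier := S\<rparr>) B" "h ` S = carrier B"
    unfolding hom_images_def subalgebras_def products_def by clarsimp blast
  define s where "s b = (SOME x. x \<in> S \<and> h x = b)" for b
  have s: "s b \<in> S" "h (s b) = b" if "b \<in> carrier B" for b
  proof -
    have "\<exists>x. x \<in> S \<and> h x = b" using that h(2) by (metis image_iff)
    from someI_ex[OF this] show "s b \<in> S" "h (s b) = b" unfolding s_def by auto
  qed
  define p where "p j = (A j, \<lambda>b. s b j)" for j
  define u where "u x = (\<lambda>j\<in>J. x (p j))" for x :: "'a rl \<times> ('a \<Rightarrow> 'a) \<Rightarrow> 'a"
  let ?P = "rl_product (p ` J) fst :: ('a rl \<times> ('a \<Rightarrow> 'a) \<Rightarrow> 'a) rl"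
  define T where "T = {x \<in> carrier ?P. u x \<in> S}"
  have fst_p [simp]: "fst (p j) = A j" for j by (simp add: p_def)
  have ops: "u (x \<otimes>\<^bsub>?P\<^esub> y) = u x \<otimes>\<^bsub>rl_product J A\<^esub> u y"
    "u (x \<^bold>\<and>\<^bsub>?P\<^esub> y) = u x \<^bold>\<and>\<^bsub>rl_product J A\<^esub> u y"
    "u (x \<^bold>\<or>\<^bsub>?P\<^esub> y) = u x \<^bold>\<or>\<^bsub>rl_product J A\<^esub> u y"
    "u (rl_ldiv ?P x y) = rl_ldiv (rl_product J A) (u x) (u y)"
    "u (rl_rdiv ?P x y) = rl_rdiv (rl_product J A) (u x) (u y)" 
    "u \<one>\<^bsub>?P\<^esub> = \<one>\<^bsub>rl_product J A\<^esub>" for x y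
    by (auto simp: rl_product_def u_def fun_eq_iff)
  have lift: "x \<in> carrier ?P" if "u x \<in> S" "x \<in> extensional (p ` J)" for x
  proof -
    have "u x \<in> carrier (rl_product J A)" using that S by (auto simp: rl_subuniverse_def)
    then show ?thesis using that(2) by (fastforce simp: rl_product_def u_def PiE_iff)
  qed
  have T: "rl_subuniverse T ?P"
    unfolding rl_subuniverse_def
  proof (intro conjI ballI)
    show "T \<subseteq> carrier ?P" by (auto simp: T_def)
    have 1: "x \<in> T" if "u x \<in> S" "x \<in> extensional (p ` J)" for x
      using lift[OF that] that by (auto simp: T_def)
    show "\<one>\<^bsub>?P\<^esub> \<in> T"
      by (rule 1) (use S ops in \<open>auto simp: rl_subuniverse_def\<close>, auto simp: rl_product_def)
    fix x y assume "x \<in> T" "y \<in> T"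
    then have xy: "u x \<in> S" "u y \<in> S" by (auto simp: T_def)
    show "x \<otimes>\<^bsub>?P\<^esub> y \<in> T" "x \<^bold>\<and>\<^bsub>?P\<^esub> y \<in> T" "x \<^bold>\<or>\<^bsub>?P\<^esub> y \<in> T"
      "rl_ldiv ?P x y \<in> T" "rl_rdiv ?P x y \<in> T"
      by (rule 1; use S xy ops in \<open>auto simp: rl_subuniverse_def\<close>; auto simp: rl_product_def)+
  qed
  have "h \<circ> u \<in> rl_hom (?P\<lparr>carrier := T\<rparr>) B"
    using h(1) ops by (auto simp: rl_hom_def T_def Pi_iff)
  moreover have "(h \<circ> u) ` T = carrier B"
  proof
    show "(h \<circ> u) ` T \<subseteq> carrier B" using h(2) by (auto simp: T_def)
    show "carrier B \<subseteq> (h \<circ> u) ` T"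
    proof
      fix b assume b: "b \<in> carrier B"
      define x where "x = (\<lambda>q\<in>p ` J. snd q b)"
      have "s b \<in> carrier (rl_product J A)" using s[OF b] S by (auto simp: rl_subuniverse_def)
      then have "u x = s b"
        by (auto simp: u_def x_def p_def rl_product_def PiE_iff fun_eq_iff extensional_def)
      moreover have "x \<in> T"
        using lift[of x] s[OF b] \<open>u x = s b\<close> by (auto simp: T_def x_def)
      ultimately show "b \<in> (h \<circ> u) ` T" using s[OF b] by (metis comp_apply image_eqI)
    qed
  qed
  moreover have "?P\<lparr>carrier := T\<rparr> \<in> subalgebras (products C)"
  proof -
    have "?P \<in> products C" unfolding products_def using A by force
    then show ?thesis unfolding subalgebras_def using T by blast
  qed
  ultimately have "B \<in> hom_images (subalgebras (products C :: ('a rl \<times> ('a \<Rightarrow> 'a) \<Rightarrow> 'a) rl set))"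
    unfolding hom_images_def by (intro CollectI bexI) auto
  then show "B \<in> C" using assms by (auto simp: is_variety_def)
qed


lemma variety_closed_HS:
  assumes C: "is_variety C" and A: "A \<in> C" and S: "rl_subuniverse S A"
    and h: "h \<in> rl_hom (A\<lparr>carrier := S\<rparr>) B" "h ` S = carrier B"
  shows "B \<in> C"
proof -
  let ?P = "rl_product UNIV (\<lambda>_ :: unit. A)" and ?T = "{x. x () \<in> S}"
  have "?P \<in> products C" unfolding products_def using A by blast
  moreover have "rl_subuniverse ?T ?P"
    using S by (auto simp: rl_subuniverse_def rl_product_def)
  ultimately have "?P\<lparr>carrier := ?T\<rparr> \<in> subalgebras (products C)"
    unfolding subalgebras_def by blast
  moreover have "(\<lambda>x. h (x ())) \<in> rl_hom (?P\<lparr>carrier := ?T\<rparr>) B"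
    using h(1) by (auto simp: rl_hom_def rl_product_def)
  moreover have "(\<lambda>x. h (x ())) ` ?T = carrier B"
    unfolding h(2)[symmetric]
  proof (intro equalityI subsetI)
    fix b assume "b \<in> h ` S"
    then obtain x where "x \<in> S" "b = h x" by blast
    then show "b \<in> (\<lambda>x. h (x ())) ` ?T" by (intro image_eqI[of _ _ "\<lambda>_. x"]) auto
  qed auto
  ultimately have "B \<in> hom_images (subalgebras (products C :: (unit \<Rightarrow> _) rl set))"
    unfolding hom_images_def by (intro CollectI bexI) auto
  with variety_closed_HSP[OF C] show ?thesis by blast
qed

definition variety_generated_by :: "'a rl set \<Rightarrow> 'a rl set"
  where "variety_generated_by K = \<Inter>{C. is_variety C \<and> K \<subseteq> C}"


section \<open>Kites\<close>

fun kite_index :: "'i set \<Rightarrow> 'i set \<Rightarrow> ('i \<Rightarrow> 'i) \<Rightarrow> nat \<Rightarrow> 'i set"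
  where
    "kite_index I0 I1 lam 0 = I0"
  | "kite_index I0 I1 lam (Suc 0) = I1"
  | "kite_index I0 I1 lam (Suc (Suc n)) =
       {i \<in> kite_index I0 I1 lam (Suc n). lam i \<in> kite_index I0 I1 lam (Suc n)}"

text \<open>The pair \<open>(n, x)\<close> with \<open>x\<close> extensional on \<open>I\<^sub>n\<close> stands for the element
  \<open>\<langle>x\<^sub>i : i \<in> I\<^sub>n\<rangle>\<close>; the first component keeps the parts \<open>G\<^bsup>I\<^sub>n\<^esup>\<close> disjoint.\<close>

definition kite_carrier :: "'g rl \<Rightarrow> (nat \<Rightarrow> 'i set) \<Rightarrow> (nat \<times> ('i \<Rightarrow> 'g)) set"
  where "kite_carrier G I = (SIGMA n:UNIV. I n \<rightarrow>\<^sub>E carrier G)"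

definition kite_le :: "'g rl \<Rightarrow> (nat \<Rightarrow> 'i set) \<Rightarrow>
    nat \<times> ('i \<Rightarrow> 'g) \<Rightarrow> nat \<times> ('i \<Rightarrow> 'g) \<Rightarrow> bool"
  where "kite_le G I = (\<lambda>(n, x) (m, y).
    m < n \<or> m = n \<and> (\<forall>i \<in> I n. x i \<preceq>\<^bsub>G\<^esub> y i))"

text \<open>Meet and join are those of the order \<open>kite_le\<close>, see \<open>kite_meet_join\<close> below. In
  \<open>rl_rdiv\<close>, \<open>\<lambda>\<^sup>-\<^sup>m\<close> is the inverse on its image of the injection \<open>\<lambda>\<^sup>m\<close> from \<open>I\<^sub>m\<close> to \<open>I\<^sub>0\<close>.\<close>

definition kite :: "'g rl \<Rightarrow> 'i set \<Rightarrow> 'i set \<Rightarrow> ('i \<Rightarrow> 'i) \<Rightarrow> (nat \<times> ('i \<Rightarrow> 'g)) rl"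
  where "kite G I0 I1 lam = (let I = kite_index I0 I1 lam in
    \<lparr>carrier = kite_carrier G I,
     mult = (\<lambda>(m, x) (n, y). (m + n, \<lambda>i\<in>I (m + n). x ((lam ^^ n) i) \<otimes>\<^bsub>G\<^esub> y i)),
     one = (0, \<lambda>i\<in>I 0. \<one>\<^bsub>G\<^esub>),
     rl_meet = (\<lambda>(n, x) (m, y).
       if m < n then (n, x) else if n < m then (m, y)
       else (n, \<lambda>i\<in>I n. x i \<^bold>\<and>\<^bsub>G\<^esub> y i)),
     rl_join = (\<lambda>(n, x) (m, y).
       if m < n then (m, y) else if n < m then (n, x)
       else (n, \<lambda>i\<in>I n. x i \<^bold>\<or>\<^bsub>G\<^esub> y i)),
     rl_ldiv = (\<lambda>(n, y) (m, x).
       if n > m then (0, \<lambda>i\<in>I 0. \<one>\<^bsub>G\<^esub>)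
       else (m - n, \<lambda>i\<in>I (m - n).
         if i \<in> I m then rl_ldiv G (y ((lam ^^ (m - n)) i)) (x i) else \<one>\<^bsub>G\<^esub>)),
     rl_rdiv = (\<lambda>(n, y) (m, x).
       if m > n then (0, \<lambda>i\<in>I 0. \<one>\<^bsub>G\<^esub>)
       else (n - m, \<lambda>i\<in>I (n - m).
         if i \<in> (lam ^^ m) ` I n
         then let j = the_inv_into (I m) (lam ^^ m) i in rl_rdiv G (y j) (x j)
         else \<one>\<^bsub>G\<^esub>))\<rparr>)"

lemma kite_meet_join:
  assumes G: "residuated_lattice G"
    and x: "x \<in> kite_carrier G (kite_index I0 I1 lam)" and y: "y \<in> kite_carrier G (kite_index I0 I1 lam)"
    and z: "z \<in> kite_carrier G (kite_index I0 I1 lam)"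
  shows "kite_le G (kite_index I0 I1 lam) z (x \<^bold>\<and>\<^bsub>kite G I0 I1 lam\<^esub> y) \<longleftrightarrow>
      kite_le G (kite_index I0 I1 lam) z x \<and> kite_le G (kite_index I0 I1 lam) z y"
    "kite_le G (kite_index I0 I1 lam) (x \<^bold>\<or>\<^bsub>kite G I0 I1 lam\<^esub> y) z \<longleftrightarrow>
      kite_le G (kite_index I0 I1 lam) x z \<and> kite_le G (kite_index I0 I1 lam) y z"
    "x \<preceq>\<^bsub>kite G I0 I1 lam\<^esub> y \<longleftrightarrow> kite_le G (kite_index I0 I1 lam) x y"
proof -
  interpret residuated_lattice G by fact
  obtain n x' m y' k z' where *: "x = (n, x')" "y = (m, y')" "z = (k, z')"
    by (metis surj_pair)
  show "kite_le G (kite_index I0 I1 lam) z (x \<^bold>\<and>\<^bsub>kite G I0 I1 lam\<^esub> y) \<longleftrightarrow>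
      kite_le G (kite_index I0 I1 lam) z x \<and> kite_le G (kite_index I0 I1 lam) z y"
   using x y z unfolding *
   by (cases n m rule: linorder_cases; auto simp: kite_def Let_def kite_le_def kite_carrier_def PiE_iff le_meet)
  show "kite_le G (kite_index I0 I1 lam) (x \<^bold>\<or>\<^bsub>kite G I0 I1 lam\<^esub> y) z \<longleftrightarrow>
      kite_le G (kite_index I0 I1 lam) x z \<and> kite_le G (kite_index I0 I1 lam) y z"
   using x y z unfolding *
   by (cases n m rule: linorder_cases; auto simp: kite_def Let_def kite_le_def kite_carrier_def PiE_iff le_join)
  show "x \<preceq>\<^bsub>kite G I0 I1 lam\<^esub> y \<longleftrightarrow> kite_le G (kite_index I0 I1 lam) x y"
  proof (cases n m rule: linorder_cases)
    case equal
    let ?I = "kite_index I0 I1 lam n"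
    have "x' \<in> extensional ?I" using x unfolding * by (auto simp: kite_carrier_def PiE_iff)
    then have "(\<lambda>i\<in>?I. x' i \<^bold>\<and>\<^bsub>G\<^esub> y' i) = x' \<longleftrightarrow> (\<forall>i\<in>?I. x' i \<^bold>\<and>\<^bsub>G\<^esub> y' i = x' i)"
      by (subst fun_eq_iff) (auto simp: extensional_def)
    then show ?thesis using equal
      unfolding * rl_le_def kite_def Let_def kite_le_def by (simp add: rl_le_def)
  qed (simp_all add: * rl_le_def kite_def Let_def kite_le_def)
qed

definition kite_data :: "'g rl \<Rightarrow> 'i set \<Rightarrow> 'i set \<Rightarrow> ('i \<Rightarrow> 'i) \<Rightarrow> bool"
  where "kite_data G I0 I1 lam \<longleftrightarrow>
    integral_residuated_lattice G \<and> I1 \<subseteq> I0 \<and> lam \<in> I1 \<rightarrow> I0 \<and> inj_on lam I1"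

text \<open>Here \<open>I\<^sub>0\<close> ranges over all sets in the arbitrary type \<open>'i\<close> and \<open>G\<close> over all integral
  residuated lattices on a subset of the arbitrary type \<open>'g\<close>. The type of kite elements is always
  infinite, so a variety is determined by its members over that type.\<close>

definition kites :: "(nat \<times> ('i \<Rightarrow> 'g)) rl set"
  where "kites = {kite G I0 I1 lam | G I0 I1 lam. kite_data G I0 I1 lam}"

definition finite_dim_kites :: "(nat \<times> ('i \<Rightarrow> 'g)) rl set"
  where "finite_dim_kites = {kite G I0 I1 lam | G I0 I1 lam. kite_data G I0 I1 lam \<and> finite I0}"

end

theory Submission
  imports Defs
begin

text \<open>Only one direction has content: a variety containing the finite-dimensional kites contains
  every kite \<open>K\<close> with data \<open>G\<close>, \<open>I\<^sub>1 \<subseteq> I\<^sub>0\<close>, \<open>\<lambda>\<close>. The idea is to obtain \<open>K\<close> as a limit of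
  finite-dimensional kites over the same \<open>G\<close>.

  For finite \<open>F \<subseteq> I\<^sub>0\<close>, cutting \<open>\<lambda>\<close> down to those \<open>i \<in> F \<inter> I\<^sub>1\<close> with \<open>\<lambda> i \<in> F\<close> leaves an injective
  partial map on \<open>F\<close>, hence a finite-dimensional kite \<open>K\<^sub>F\<close>. Restriction of coordinates \<open>K \<rightarrow> K\<^sub>F\<close>
  respects everything except the two divisions, which go wrong at those \<open>i \<in> F\<close>
  where a required image or preimage under a power of \<open>\<lambda>\<close> has been cut off. But each single coordinate is computed from finitely many points
  of \<open>I\<^sub>0\<close>, so at that coordinate the error disappears once \<open>F\<close> is large enough.

  Accordingly, in the product of all \<open>K\<^sub>F\<close> consider the families whose components all have the same
  degree \<open>n\<close> (the first component of the pair) and in which every coordinate \<open>i \<in> I\<^sub>n\<close> is eventually constant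
  along the directed set of finite subsets \<open>F\<close> (\<open>converges\<close>). They form a subalgebra, taking the
  limit is a homomorphism from it to \<open>K\<close>, and this is onto because the restrictions of an element of
  \<open>K\<close> converge to it (\<open>converges_restrict\<close>). So \<open>K\<close> is a homomorphic image of a subalgebra of a
  product of finite-dimensional kites (\<open>kite_in_HSP\<close>). The crucial cases are the divisions,
  \<open>converges_ldiv\<close> and \<open>converges_rdiv\<close>.\<close>

section \<open>Domains of the powers of a partial injection\<close>

locale partial_injection =
  fixes I0 I1 :: "'i set" and lam :: "'i \<Rightarrow> 'i"
  assumes dom_subset: "I1 \<subseteq> I0" and lam_maps: "lam \<in> I1 \<rightarrow> I0" and lam_inj: "inj_on lam I1"
begin

abbreviation I where "I \<equiv> kite_index I0 I1 lam"

text \<open>The recursive definition of \<open>I\<^sub>n\<close> says that \<open>I\<^sub>n\<close> is the domain of the \<open>n\<close>-th power of the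
  partial map; all facts about index sets below are read off from this.\<close>

lemma mem_index_iff: "i \<in> I n \<longleftrightarrow> i \<in> I0 \<and> (\<forall>k<n. (lam ^^ k) i \<in> I1)"
proof (induction n arbitrary: i rule: induct_nat_012)
  case (ge2 n)
  have "(\<forall>k<Suc (Suc n). (lam ^^ k) i \<in> I1) \<longleftrightarrow>
      (\<forall>k<Suc n. (lam ^^ k) i \<in> I1) \<and> (\<forall>k<Suc n. (lam ^^ k) (lam i) \<in> I1)"
    unfolding funpow_swap1[symmetric] funpow.simps(2)[unfolded comp_def fun_eq_iff, rule_format, symmetric]
    by (metis less_Suc_eq less_Suc_eq_0_disj Suc_less_eq zero_less_Suc)
  moreover have "i \<in> I1 \<Longrightarrow> lam i \<in> I0" using lam_maps by auto
  ultimately show ?case using ge2[of i] ge2[of "lam i"]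
    by (auto simp del: funpow.simps)
qed (use dom_subset in auto)

lemma index_antimono: "n \<le> m \<Longrightarrow> i \<in> I m \<Longrightarrow> i \<in> I n"
  by (simp add: mem_index_iff)

lemma power_mem:
  assumes "i \<in> I n"
  shows "(lam ^^ n) i \<in> I0"
proof (cases n)
  case (Suc k)
  then have "(lam ^^ k) i \<in> I1" using assms by (simp add: mem_index_iff)
  then show ?thesis using lam_maps Suc by auto
qed (use assms in simp)

lemma index_add: "i \<in> I (m + n) \<longleftrightarrow> i \<in> I n \<and> (lam ^^ n) i \<in> I m"
proof -
  have "(lam ^^ k) i \<in> I1"
    if "\<forall>k<n. (lam ^^ k) i \<in> I1" "\<forall>k<m. (lam ^^ (k + n)) i \<in> I1" "k < m + n" for k
  proof (cases "k < n")
    case False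
    then have "k = (k - n) + n" "k - n < m" using that(3) by auto
    then show ?thesis using that(2) by metis
  qed (use that in simp)
  then have "(\<forall>k<m + n. (lam ^^ k) i \<in> I1) \<longleftrightarrow>
      (\<forall>k<n. (lam ^^ k) i \<in> I1) \<and> (\<forall>k<m. (lam ^^ (k + n)) i \<in> I1)"
    by auto
  then show ?thesis using power_mem[of i n] by (auto simp: mem_index_iff funpow_add)
qed

lemma power_inj: "inj_on (lam ^^ n) (I n)"
proof (induction n)
  case (Suc n)
  have "inj_on (lam ^^ n) (I (Suc n))"
    by (rule inj_on_subset[OF Suc]) (auto intro: index_antimono[of n "Suc n"])
  moreover have "(lam ^^ n) ` I (Suc n) \<subseteq> I1" by (auto simp: mem_index_iff)
  ultimately show ?case
    unfolding funpow.simps using inj_on_subset[OF lam_inj] by (intro comp_inj_on)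
qed simp

lemma inverse_power:
  "m \<le> n \<Longrightarrow> j \<in> I n \<Longrightarrow> the_inv_into (I m) (lam ^^ m) ((lam ^^ m) j) = j"
  using index_antimono power_inj by (intro the_inv_into_f_f) auto

end

section \<open>Operations of a kite\<close>

lemma kite_simps:
  "carrier (kite G I0 I1 lam) = kite_carrier G (kite_index I0 I1 lam)"
  "\<one>\<^bsub>kite G I0 I1 lam\<^esub> = (0, \<lambda>i\<in>I0. \<one>\<^bsub>G\<^esub>)"
  "(m, x) \<otimes>\<^bsub>kite G I0 I1 lam\<^esub> (n, y) =
     (m + n, \<lambda>i\<in>kite_index I0 I1 lam (m + n). x ((lam ^^ n) i) \<otimes>\<^bsub>G\<^esub> y i)"
  "(m, x) \<^bold>\<and>\<^bsub>kite G I0 I1 lam\<^esub> (n, y) = (if n < m then (m, x) else if m < n then (n, y)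
     else (m, \<lambda>i\<in>kite_index I0 I1 lam m. x i \<^bold>\<and>\<^bsub>G\<^esub> y i))"
  "(m, x) \<^bold>\<or>\<^bsub>kite G I0 I1 lam\<^esub> (n, y) = (if n < m then (n, y) else if m < n then (m, x)
     else (m, \<lambda>i\<in>kite_index I0 I1 lam m. x i \<^bold>\<or>\<^bsub>G\<^esub> y i))"
  "rl_ldiv (kite G I0 I1 lam) (m, x) (n, y) = (if m > n then (0, \<lambda>i\<in>I0. \<one>\<^bsub>G\<^esub>)
     else (n - m, \<lambda>i\<in>kite_index I0 I1 lam (n - m). if i \<in> kite_index I0 I1 lam n
       then rl_ldiv G (x ((lam ^^ (n - m)) i)) (y i) else \<one>\<^bsub>G\<^esub>))"
  "rl_rdiv (kite G I0 I1 lam) (m, x) (n, y) = (if n > m then (0, \<lambda>i\<in>I0. \<one>\<^bsub>G\<^esub>)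
     else (m - n, \<lambda>i\<in>kite_index I0 I1 lam (m - n). if i \<in> (lam ^^ n) ` kite_index I0 I1 lam m
       then (let j = the_inv_into (kite_index I0 I1 lam n) (lam ^^ n) i in rl_rdiv G (x j) (y j))
       else \<one>\<^bsub>G\<^esub>))"
  by (simp_all add: kite_def Let_def)

locale kite_alg = partial_injection I0 I1 lam + residuated_lattice G
  for I0 I1 :: "'i set" and lam :: "'i \<Rightarrow> 'i" and G :: "'g rl"
begin

abbreviation K where "K \<equiv> kite G I0 I1 lam"

text \<open>Being a subuniverse of itself is a compact way of saying that the carrier is closed under the
  operations.\<close>

lemma kite_closed: "rl_subuniverse (carrier K) K"
  unfolding rl_subuniverse_def
proof (intro conjI ballI)
  show "\<one>\<^bsub>K\<^esub> \<in> carrier K" by (simp add: kite_simps kite_carrier_def)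
next
  fix z w assume "z \<in> carrier K" "w \<in> carrier K"
  then obtain m x n y where zw: "z = (m, x)" "w = (n, y)"
    and x: "x \<in> I m \<rightarrow>\<^sub>E carrier G" and y: "y \<in> I n \<rightarrow>\<^sub>E carrier G"
    by (auto simp: kite_simps kite_carrier_def)
  show "z \<otimes>\<^bsub>K\<^esub> w \<in> carrier K"
    using x y by (auto simp: zw kite_simps kite_carrier_def index_add intro!: m_closed)
  show "z \<^bold>\<and>\<^bsub>K\<^esub> w \<in> carrier K"
    using x y by (auto simp: zw kite_simps kite_carrier_def intro!: meet_closed)
  show "z \<^bold>\<or>\<^bsub>K\<^esub> w \<in> carrier K"
    using x y by (auto simp: zw kite_simps kite_carrier_def intro!: join_closed)
  show "rl_ldiv K z w \<in> carrier K"
  proof (cases "n < m")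
    case False
    then have "(lam ^^ (n - m)) i \<in> I m" if "i \<in> I n" for i
      using that index_add[of i m "n - m"] by simp
    then show ?thesis
      using PiE_mem[OF x] PiE_mem[OF y]
      by (auto simp: zw kite_simps kite_carrier_def intro!: ldiv_closed)
  qed (simp add: zw kite_simps kite_carrier_def)
  show "rl_rdiv K z w \<in> carrier K"
  proof (cases "m < n")
    case False
    then have "the_inv_into (I n) (lam ^^ n) ((lam ^^ n) j) = j" "j \<in> I n" if "j \<in> I m" for j
      using that inverse_power[of n m] index_antimono[of n m] by auto
    then show ?thesis
      using PiE_mem[OF x] PiE_mem[OF y]
      by (auto simp: zw kite_simps kite_carrier_def Let_def intro!: rdiv_closed)
  qed (simp add: zw kite_simps kite_carrier_def)
qed auto

end

section \<open>Truncation to finite index sets\<close>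

text \<open>The domain of \<open>\<lambda>\<close> cut down to \<open>F\<close>: both a point and its image have to lie in \<open>F\<close>, as the
  truncated map must take values in \<open>F\<close>.\<close>

definition trunc :: "'i set \<Rightarrow> ('i \<Rightarrow> 'i) \<Rightarrow> 'i set \<Rightarrow> 'i set"
  where "trunc I1 lam F = {i \<in> F \<inter> I1. lam i \<in> F}"

context partial_injection
begin

abbreviation J where "J \<equiv> {F. finite F \<and> F \<subseteq> I0}"

abbreviation TI where "TI F \<equiv> kite_index F (trunc I1 lam F) lam"

lemma trunc_partial_injection: "partial_injection F (trunc I1 lam F) lam"
  using lam_inj by unfold_locales (auto simp: trunc_def inj_on_def)

lemmas mem_trunc_index_iff = partial_injection.mem_index_iff[OF trunc_partial_injection]

lemma trunc_index_subset:
  assumes "F \<subseteq> I0" and "i \<in> TI F n"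
  shows "i \<in> I n"
  using assms unfolding mem_index_iff mem_trunc_index_iff by (auto simp: trunc_def)

lemma eventually_J: "eventually (\<lambda>F. F \<in> J) (finite_subsets_at_top I0)"
  by (auto simp: eventually_finite_subsets_at_top)

text \<open>Membership of \<open>i\<close> in the truncated \<open>I\<^sub>n\<close> only needs the \<open>n + 1\<close> points
  \<open>i, \<lambda> i, \<dots>, \<lambda>\<^sup>n i\<close> to be in \<open>F\<close>. Together with \<open>trunc_index_subset\<close> this shows that at every point
  truncation eventually gives the right domain.\<close>

lemma eventually_trunc_index:
  assumes "i \<in> I n"
  shows "eventually (\<lambda>F. i \<in> TI F n) (finite_subsets_at_top I0)"
  unfolding eventually_finite_subsets_at_top
proof (intro exI[of _ "(\<lambda>k. (lam ^^ k) i) ` {..n}"] conjI allI impI)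
  show "(\<lambda>k. (lam ^^ k) i) ` {..n} \<subseteq> I0"
    using assms power_mem index_antimono by blast
next
  fix F assume F: "finite F \<and> (\<lambda>k. (lam ^^ k) i) ` {..n} \<subseteq> F \<and> F \<subseteq> I0"
  have *: "(lam ^^ k) i \<in> F" if "k \<le> n" for k using F that by auto
  show "i \<in> TI F n"
    using assms *[of 0] * *[of "Suc _"]
    unfolding mem_index_iff mem_trunc_index_iff by (auto simp: trunc_def Suc_le_eq)
qed auto

end

section \<open>Limits of truncations\<close>

context kite_alg
begin

abbreviation KF where "KF F \<equiv> kite G F (trunc I1 lam F) lam"

lemma trunc_kite_alg: "kite_alg F (trunc I1 lam F) lam G"
  by (intro kite_alg.intro trunc_partial_injection residuated_lattice_axioms)

text \<open>The degree is required to be right at every \<open>F\<close>, so that a family and its limit take the same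
  branch in the case distinctions of the operations. No uniformity over the coordinates is asked for:
  how large \<open>F\<close> must be may depend on \<open>i\<close>.\<close>

definition converges :: "('i set \<Rightarrow> nat \<times> ('i \<Rightarrow> 'g)) \<Rightarrow> nat \<times> ('i \<Rightarrow> 'g) \<Rightarrow> bool"
  where "converges a z \<longleftrightarrow> a \<in> carrier (rl_product J KF) \<and> z \<in> carrier K \<and>
    (\<forall>F\<in>J. fst (a F) = fst z) \<and>
    (\<forall>i\<in>I (fst z). eventually (\<lambda>F. snd (a F) i = snd z i) (finite_subsets_at_top I0))"

text \<open>There are finite sets beyond any given finite set, so two eventual values coincide.\<close>

lemma converges_unique:
  assumes "converges a z" and "converges a w"
  shows "z = w"
proof -
  have deg: "fst z = fst w" using assms by (auto simp: converges_def)
  have "snd z i = snd w i" if "i \<in> I (fst z)" for i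
  proof -
    have "eventually (\<lambda>F. snd (a F) i = snd z i) (finite_subsets_at_top I0)"
      "eventually (\<lambda>F. snd (a F) i = snd w i) (finite_subsets_at_top I0)"
      using assms that deg by (simp_all add: converges_def)
    then have "eventually (\<lambda>F. snd z i = snd w i) (finite_subsets_at_top I0)"
      by eventually_elim simp
    then show ?thesis by simp
  qed
  moreover have "snd z \<in> extensional (I (fst z))" "snd w \<in> extensional (I (fst z))"
    using assms deg by (auto simp: converges_def kite_simps kite_carrier_def PiE_iff)
  ultimately show ?thesis using deg by (intro prod_eqI extensionalityI) auto
qed

lemma converges_restrict:
  assumes "z \<in> carrier K"
  shows "converges (\<lambda>F\<in>J. (fst z, restrict (snd z) (TI F (fst z)))) z"
proof -
  have *: "eventually (\<lambda>F. snd ((\<lambda>F\<in>J. (fst z, restrict (snd z) (TI F (fst z)))) F) i = snd z i)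
      (finite_subsets_at_top I0)" if "i \<in> I (fst z)" for i
    using eventually_trunc_index[OF that] eventually_J by eventually_elim simp
  have "(fst z, restrict (snd z) (TI F (fst z))) \<in> carrier (KF F)" if "F \<in> J" for F
    using assms that trunc_index_subset[of F _ "fst z"]
    by (auto simp: kite_simps kite_carrier_def)
  then show ?thesis
    using assms * by (simp add: converges_def rl_product_def)
qed

text \<open>What remains to be checked for each binary operation: the degree of the result depends on the
  degrees of the arguments alone (\<open>deg\<close>), and each coordinate of the result eventually stabilizes if
  those of the arguments do (\<open>coord\<close>).\<close>

lemma converges_op:
  assumes a: "converges a z" and b: "converges b w"
    and closed: "f z w \<in> carrier K"
      "\<And>F x y. x \<in> carrier (KF F) \<Longrightarrow> y \<in> carrier (KF F) \<Longrightarrow> g F x y \<in> carrier (KF F)"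
    and deg: "\<And>F m x x' n y y'. z = (m, x) \<Longrightarrow> w = (n, y) \<Longrightarrow>
      fst (g F (m, x') (n, y')) = fst (f (m, x) (n, y))"
    and coord: "\<And>m x X n y Y i. z = (m, x) \<Longrightarrow> w = (n, y) \<Longrightarrow>
      (\<And>j. j \<in> I m \<Longrightarrow> eventually (\<lambda>F. X F j = x j) (finite_subsets_at_top I0)) \<Longrightarrow>
      (\<And>j. j \<in> I n \<Longrightarrow> eventually (\<lambda>F. Y F j = y j) (finite_subsets_at_top I0)) \<Longrightarrow>
      i \<in> I (fst (f (m, x) (n, y))) \<Longrightarrow>
      eventually (\<lambda>F. snd (g F (m, X F) (n, Y F)) i = snd (f (m, x) (n, y)) i)
        (finite_subsets_at_top I0)"
  shows "converges (\<lambda>F\<in>J. g F (a F) (b F)) (f z w)"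
proof -
  obtain m x n y where zw: "z = (m, x)" "w = (n, y)" by fastforce
  define X Y where "X F = snd (a F)" and "Y F = snd (b F)" for F
  have aF: "a F = (m, X F)" and bF: "b F = (n, Y F)" if "F \<in> J" for F
    using that a b by (auto simp: converges_def X_def Y_def zw prod_eq_iff)
  have "eventually (\<lambda>F. snd ((\<lambda>F\<in>J. g F (a F) (b F)) F) i = snd (f z w) i)
      (finite_subsets_at_top I0)" if i: "i \<in> I (fst (f z w))" for i
  proof -
    have "eventually (\<lambda>F. snd (g F (m, X F) (n, Y F)) i = snd (f (m, x) (n, y)) i)
        (finite_subsets_at_top I0)"
      using a b i by (intro coord[OF zw]) (auto simp: zw converges_def X_def Y_def)
    then show ?thesis
      using eventually_J by eventually_elim (simp add: aF bF zw)
  qed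
  moreover have "fst (g F (a F) (b F)) = fst (f z w)" if "F \<in> J" for F
    using aF[OF that] bF[OF that] deg[OF zw] by (simp add: zw)
  moreover have "g F (a F) (b F) \<in> carrier (KF F)" if "F \<in> J" for F
    using that a b by (intro closed) (auto simp: converges_def rl_product_def)
  ultimately show ?thesis
    using closed(1) by (simp add: converges_def rl_product_def)
qed

lemmas trunc_kite_closed = kite_alg.kite_closed[OF trunc_kite_alg]

lemma converges_one: "converges \<one>\<^bsub>rl_product J KF\<^esub> \<one>\<^bsub>K\<^esub>"
proof -
  have "eventually (\<lambda>F. snd ((\<lambda>F\<in>J. \<one>\<^bsub>KF F\<^esub>) F) i = snd \<one>\<^bsub>K\<^esub> i) (finite_subsets_at_top I0)"
    if "i \<in> I0" for i
    using eventually_trunc_index[of i 0] eventually_J that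
    by (auto simp: kite_simps elim: eventually_elim2)
  moreover have "\<one>\<^bsub>KF F\<^esub> \<in> carrier (KF F)" for F
    using trunc_kite_closed[of F] by (simp add: rl_subuniverse_def)
  moreover have "\<one>\<^bsub>K\<^esub> \<in> carrier K" using kite_closed by (simp add: rl_subuniverse_def)
  moreover have "fst \<one>\<^bsub>K\<^esub> = 0" "fst \<one>\<^bsub>KF F\<^esub> = 0" for F by (simp_all add: kite_simps)
  ultimately show ?thesis
    by (simp add: converges_def rl_product_def)
qed

text \<open>Coordinate \<open>i\<close> of a product depends only on coordinates \<open>\<lambda>\<^sup>n i\<close> and \<open>i\<close> of the factors.\<close>

lemma converges_mult:
  assumes "converges a z" and "converges b w"
  shows "converges (a \<otimes>\<^bsub>rl_product J KF\<^esub> b) (z \<otimes>\<^bsub>K\<^esub> w)"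
proof -
  have "converges (\<lambda>F\<in>J. a F \<otimes>\<^bsub>KF F\<^esub> b F) (z \<otimes>\<^bsub>K\<^esub> w)"
  proof (rule converges_op[OF assms])
    show "z \<otimes>\<^bsub>K\<^esub> w \<in> carrier K"
      using assms kite_closed by (auto simp: converges_def rl_subuniverse_def)
  next
    fix m x X n y Y i
    assume X: "\<And>j. j \<in> I m \<Longrightarrow> eventually (\<lambda>F. X F j = x j) (finite_subsets_at_top I0)"
      and Y: "\<And>j. j \<in> I n \<Longrightarrow> eventually (\<lambda>F. Y F j = y j) (finite_subsets_at_top I0)"
      and "i \<in> I (fst ((m, x) \<otimes>\<^bsub>K\<^esub> (n, y)))"
    then have i: "i \<in> I (m + n)" by (simp add: kite_simps)
    then have "i \<in> I n" "(lam ^^ n) i \<in> I m" by (simp_all add: index_add)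
    from Y[OF this(1)] X[OF this(2)] eventually_trunc_index[OF i]
    show "eventually (\<lambda>F. snd ((m, X F) \<otimes>\<^bsub>KF F\<^esub> (n, Y F)) i = snd ((m, x) \<otimes>\<^bsub>K\<^esub> (n, y)) i)
        (finite_subsets_at_top I0)"
      by eventually_elim (simp add: kite_simps i)
  qed (use trunc_kite_closed in \<open>auto simp: kite_simps rl_subuniverse_def\<close>)
  then show ?thesis by (simp add: rl_product_def)
qed

lemma converges_meet:
  assumes "converges a z" and "converges b w"
  shows "converges (a \<^bold>\<and>\<^bsub>rl_product J KF\<^esub> b) (z \<^bold>\<and>\<^bsub>K\<^esub> w)"
proof -
  have "converges (\<lambda>F\<in>J. a F \<^bold>\<and>\<^bsub>KF F\<^esub> b F) (z \<^bold>\<and>\<^bsub>K\<^esub> w)"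
  proof (rule converges_op[OF assms])
    show "z \<^bold>\<and>\<^bsub>K\<^esub> w \<in> carrier K"
      using assms kite_closed by (auto simp: converges_def rl_subuniverse_def)
  next
    fix m x X n y Y i
    assume X: "\<And>j. j \<in> I m \<Longrightarrow> eventually (\<lambda>F. X F j = x j) (finite_subsets_at_top I0)"
      and Y: "\<And>j. j \<in> I n \<Longrightarrow> eventually (\<lambda>F. Y F j = y j) (finite_subsets_at_top I0)"
      and i: "i \<in> I (fst ((m, x) \<^bold>\<and>\<^bsub>K\<^esub> (n, y)))"
    show "eventually (\<lambda>F. snd ((m, X F) \<^bold>\<and>\<^bsub>KF F\<^esub> (n, Y F)) i = snd ((m, x) \<^bold>\<and>\<^bsub>K\<^esub> (n, y)) i)
        (finite_subsets_at_top I0)"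
    proof (cases m n rule: linorder_cases)
      case equal
      then have i': "i \<in> I m" "i \<in> I n" using i by (simp_all add: kite_simps)
      from X[OF i'(1)] Y[OF i'(2)] eventually_trunc_index[OF i'(1)]
      show ?thesis by eventually_elim (use i' equal in \<open>simp add: kite_simps\<close>)
    qed (use X Y i in \<open>simp_all add: kite_simps\<close>)
  qed (use trunc_kite_closed in \<open>auto simp: kite_simps rl_subuniverse_def\<close>)
  then show ?thesis by (simp add: rl_product_def)
qed

lemma converges_join:
  assumes "converges a z" and "converges b w"
  shows "converges (a \<^bold>\<or>\<^bsub>rl_product J KF\<^esub> b) (z \<^bold>\<or>\<^bsub>K\<^esub> w)"
proof -
  have "converges (\<lambda>F\<in>J. a F \<^bold>\<or>\<^bsub>KF F\<^esub> b F) (z \<^bold>\<or>\<^bsub>K\<^esub> w)"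
  proof (rule converges_op[OF assms])
    show "z \<^bold>\<or>\<^bsub>K\<^esub> w \<in> carrier K"
      using assms kite_closed by (auto simp: converges_def rl_subuniverse_def)
  next
    fix m x X n y Y i
    assume X: "\<And>j. j \<in> I m \<Longrightarrow> eventually (\<lambda>F. X F j = x j) (finite_subsets_at_top I0)"
      and Y: "\<And>j. j \<in> I n \<Longrightarrow> eventually (\<lambda>F. Y F j = y j) (finite_subsets_at_top I0)"
      and i: "i \<in> I (fst ((m, x) \<^bold>\<or>\<^bsub>K\<^esub> (n, y)))"
    show "eventually (\<lambda>F. snd ((m, X F) \<^bold>\<or>\<^bsub>KF F\<^esub> (n, Y F)) i = snd ((m, x) \<^bold>\<or>\<^bsub>K\<^esub> (n, y)) i)
        (finite_subsets_at_top I0)"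
    proof (cases m n rule: linorder_cases)
      case equal
      then have i': "i \<in> I m" "i \<in> I n" using i by (simp_all add: kite_simps)
      from X[OF i'(1)] Y[OF i'(2)] eventually_trunc_index[OF i'(1)]
      show ?thesis by eventually_elim (use i' equal in \<open>simp add: kite_simps\<close>)
    qed (use X Y i in \<open>simp_all add: kite_simps\<close>)
  qed (use trunc_kite_closed in \<open>auto simp: kite_simps rl_subuniverse_def\<close>)
  then show ?thesis by (simp add: rl_product_def)
qed

text \<open>Coordinate \<open>i\<close> of a left division is a quotient or the unit, depending on whether \<open>i \<in> I\<^sub>n\<close>. In
  the first case \<open>i\<close> lies in the truncated \<open>I\<^sub>n\<close> for all large \<open>F\<close>, in the second for no \<open>F\<close> at all,
  so the truncated kites eventually make the right decision.\<close>

lemma converges_ldiv: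
  assumes "converges a z" and "converges b w"
  shows "converges (rl_ldiv (rl_product J KF) a b) (rl_ldiv K z w)"
proof -
  have "converges (\<lambda>F\<in>J. rl_ldiv (KF F) (a F) (b F)) (rl_ldiv K z w)"
  proof (rule converges_op[OF assms])
    show "rl_ldiv K z w \<in> carrier K"
      using assms kite_closed by (auto simp: converges_def rl_subuniverse_def)
  next
    fix m x X n y Y i
    assume X: "\<And>j. j \<in> I m \<Longrightarrow> eventually (\<lambda>F. X F j = x j) (finite_subsets_at_top I0)"
      and Y: "\<And>j. j \<in> I n \<Longrightarrow> eventually (\<lambda>F. Y F j = y j) (finite_subsets_at_top I0)"
      and i: "i \<in> I (fst (rl_ldiv K (m, x) (n, y)))"
    show "eventually (\<lambda>F. snd (rl_ldiv (KF F) (m, X F) (n, Y F)) i =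
        snd (rl_ldiv K (m, x) (n, y)) i) (finite_subsets_at_top I0)"
    proof (cases "n < m")
      case True
      then have "i \<in> I 0" using i by (simp add: kite_simps)
      from eventually_trunc_index[OF this] show ?thesis
        by eventually_elim (use True i in \<open>simp add: kite_simps\<close>)
    next
      case False
      then have i': "i \<in> I (n - m)" using i by (simp add: kite_simps)
      note ev = eventually_trunc_index[OF i'] eventually_J
      show ?thesis
      proof (cases "i \<in> I n")
        case True
        then have "(lam ^^ (n - m)) i \<in> I m" using index_add[of i m "n - m"] False by simp
        from X[OF this] Y[OF True] eventually_trunc_index[OF True] ev
        show ?thesis by eventually_elim (use i' True False in \<open>simp add: kite_simps\<close>)
      next
        case outside: False
        from ev show ?thesis
        proof eventually_elim
          case (elim F)
          then have "i \<notin> TI F n" using outside trunc_index_subset by auto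
          with elim i' False outside show ?case by (simp add: kite_simps)
        qed
      qed
    qed
  qed (use trunc_kite_closed in \<open>auto simp: kite_simps rl_subuniverse_def\<close>)
  then show ?thesis by (simp add: rl_product_def)
qed

text \<open>As for the left division, the decision now being whether \<open>i\<close> has a preimage \<open>j \<in> I\<^sub>m\<close> under
  \<open>\<lambda>\<^sup>n\<close>. Once \<open>j\<close> lies in the truncated index set, both inverses of \<open>\<lambda>\<^sup>n\<close> find this same \<open>j\<close>.\<close>

lemma converges_rdiv:
  assumes "converges a z" and "converges b w"
  shows "converges (rl_rdiv (rl_product J KF) a b) (rl_rdiv K z w)"
proof -
  have "converges (\<lambda>F\<in>J. rl_rdiv (KF F) (a F) (b F)) (rl_rdiv K z w)"
  proof (rule converges_op[OF assms])
    show "rl_rdiv K z w \<in> carrier K"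
      using assms kite_closed by (auto simp: converges_def rl_subuniverse_def)
  next
    fix m x X n y Y i
    assume X: "\<And>j. j \<in> I m \<Longrightarrow> eventually (\<lambda>F. X F j = x j) (finite_subsets_at_top I0)"
      and Y: "\<And>j. j \<in> I n \<Longrightarrow> eventually (\<lambda>F. Y F j = y j) (finite_subsets_at_top I0)"
      and i: "i \<in> I (fst (rl_rdiv K (m, x) (n, y)))"
    show "eventually (\<lambda>F. snd (rl_rdiv (KF F) (m, X F) (n, Y F)) i =
        snd (rl_rdiv K (m, x) (n, y)) i) (finite_subsets_at_top I0)"
    proof (cases "m < n")
      case True
      then have "i \<in> I 0" using i by (simp add: kite_simps)
      from eventually_trunc_index[OF this] show ?thesis
        by eventually_elim (use True i in \<open>simp add: kite_simps\<close>)
    next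
      case False
      then have i': "i \<in> I (m - n)" using i by (simp add: kite_simps)
      note ev = eventually_trunc_index[OF i'] eventually_J
      show ?thesis
      proof (cases "i \<in> (lam ^^ n) ` I m")
        case True
        then obtain j where j: "j \<in> I m" "i = (lam ^^ n) j" by auto
        then have "j \<in> I n" using index_antimono[of n m] False by simp
        from X[OF j(1)] Y[OF this] eventually_trunc_index[OF j(1)] ev
        show ?thesis
        proof eventually_elim
          case (elim F)
          have "the_inv_into (I n) (lam ^^ n) i = j" "the_inv_into (TI F n) (lam ^^ n) i = j"
            using False j elim inverse_power[of n m j]
              partial_injection.inverse_power[OF trunc_partial_injection, of n m j F]
            by auto
          moreover have "i \<in> (lam ^^ n) ` TI F m" using elim j by auto
          ultimately show ?case using elim i' False True by (simp add: kite_simps)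
        qed
      next
        case outside: False
        from ev show ?thesis
        proof eventually_elim
          case (elim F)
          then have "i \<notin> (lam ^^ n) ` TI F m" using outside trunc_index_subset by auto
          with elim i' False outside show ?case by (simp add: kite_simps)
        qed
      qed
    qed
  qed (use trunc_kite_closed in \<open>auto simp: kite_simps rl_subuniverse_def\<close>)
  then show ?thesis by (simp add: rl_product_def)
qed

lemma carrier_update_simps:
  fixes A :: "'a rl"
  shows "carrier (A\<lparr>carrier := S\<rparr>) = S" "\<one>\<^bsub>A\<lparr>carrier := S\<rparr>\<^esub> = \<one>\<^bsub>A\<^esub>"
    "mult (A\<lparr>carrier := S\<rparr>) = mult A" "rl_meet (A\<lparr>carrier := S\<rparr>) = rl_meet A"
    "rl_join (A\<lparr>carrier := S\<rparr>) = rl_join A" "rl_ldiv (A\<lparr>carrier := S\<rparr>) = rl_ldiv A"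
    "rl_rdiv (A\<lparr>carrier := S\<rparr>) = rl_rdiv A"
  by simp_all

lemma kite_in_HSP:
  assumes "\<And>F. F \<in> J \<Longrightarrow> KF F \<in> C"
  shows "K \<in> hom_images (subalgebras (products C :: ('i set \<Rightarrow> nat \<times> ('i \<Rightarrow> 'g)) rl set))"
proof -
  let ?P = "rl_product J KF"
  define S where "S = {a. \<exists>z. converges a z}"
  define h where "h a = (THE z. converges a z)" for a
  have h: "h a = z" if "converges a z" for a z
    unfolding h_def using that converges_unique by blast
  have limit_mem: "z \<in> carrier K" if "converges a z" for a z
    using that by (simp add: converges_def)
  note ops = converges_one converges_mult converges_meet converges_join converges_ldiv converges_rdiv
  have SI: "a \<in> S" if "converges a z" for a z using that unfolding S_def by blast
  have "rl_subuniverse S ?P"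
    unfolding rl_subuniverse_def
  proof (intro conjI ballI)
    show "S \<subseteq> carrier ?P" by (auto simp: S_def converges_def)
    show "\<one>\<^bsub>?P\<^esub> \<in> S" by (rule SI[OF converges_one])
  next
    fix a b assume "a \<in> S" "b \<in> S"
    then obtain z w where "converges a z" "converges b w" by (auto simp: S_def)
    note ops(2-)[OF this, THEN SI]
    then show "a \<otimes>\<^bsub>?P\<^esub> b \<in> S" "a \<^bold>\<and>\<^bsub>?P\<^esub> b \<in> S" "a \<^bold>\<or>\<^bsub>?P\<^esub> b \<in> S"
      "rl_ldiv ?P a b \<in> S" "rl_rdiv ?P a b \<in> S"
      by (simp_all only:)
  qed
  moreover have "?P \<in> products C"
    using assms unfolding products_def by blast
  ultimately have "?P\<lparr>carrier := S\<rparr> \<in> subalgebras (products C)"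
    unfolding subalgebras_def by blast
  moreover have "h \<in> rl_hom (?P\<lparr>carrier := S\<rparr>) K"
    unfolding rl_hom_def carrier_update_simps
  proof (intro CollectI conjI ballI)
    show "h \<in> S \<rightarrow> carrier K" using h limit_mem by (auto simp: S_def)
    show "h \<one>\<^bsub>?P\<^esub> = \<one>\<^bsub>K\<^esub>" by (rule h[OF converges_one])
  next
    fix a b assume "a \<in> S" "b \<in> S"
    then obtain z w where "converges a z" "converges b w" by (auto simp: S_def)
    note ops(2-)[OF this, THEN h] this[THEN h]
    then show "h (a \<otimes>\<^bsub>?P\<^esub> b) = h a \<otimes>\<^bsub>K\<^esub> h b"
      "h (a \<^bold>\<and>\<^bsub>?P\<^esub> b) = h a \<^bold>\<and>\<^bsub>K\<^esub> h b"
      "h (a \<^bold>\<or>\<^bsub>?P\<^esub> b) = h a \<^bold>\<or>\<^bsub>K\<^esub> h b"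
      "h (rl_ldiv ?P a b) = rl_ldiv K (h a) (h b)"
      "h (rl_rdiv ?P a b) = rl_rdiv K (h a) (h b)"
      by (simp_all only:)
  qed
  moreover have "h ` carrier (?P\<lparr>carrier := S\<rparr>) = carrier K"
    unfolding carrier_update_simps
  proof (intro equalityI subsetI)
    fix z assume "z \<in> carrier K"
    note conv = converges_restrict[OF this]
    show "z \<in> h ` S" using imageI[OF SI[OF conv], of h] by (simp only: h[OF conv])
  next
    fix z assume "z \<in> h ` S"
    then show "z \<in> carrier K" using h limit_mem by (auto simp: S_def)
  qed
  ultimately show ?thesis unfolding hom_images_def by blast
qed

end

section \<open>Generation by finite-dimensional kites\<close>

lemma kites_subset_variety:
  fixes C :: "(nat \<times> ('i \<Rightarrow> 'g)) rl set"
  assumes C: "is_variety C" and fin: "finite_dim_kites \<subseteq> C"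
  shows "kites \<subseteq> C"
proof
  fix A :: "(nat \<times> ('i \<Rightarrow> 'g)) rl"
  assume "A \<in> kites"
  then obtain G :: "'g rl" and I0 I1 :: "'i set" and lam
    where A: "A = kite G I0 I1 lam" and data: "kite_data G I0 I1 lam"
    by (auto simp: kites_def)
  interpret G: integral_residuated_lattice G using data by (simp add: kite_data_def)
  interpret kite_alg I0 I1 lam G
    using data by unfold_locales (auto simp: kite_data_def)
  have "KF F \<in> C" if "F \<in> J" for F
  proof -
    have "kite_data G F (trunc I1 lam F) lam"
      using data trunc_partial_injection[of F] by (simp add: kite_data_def partial_injection_def)
    then have "KF F \<in> finite_dim_kites" using that unfolding finite_dim_kites_def by blast
    then show ?thesis using fin by blast
  qed
  from kite_in_HSP[OF this] show "A \<in> C"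
    using variety_closed_HSP[OF C] by (auto simp: A)
qed

theorem theorem6p6:
  shows "variety_generated_by (kites :: (nat \<times> ('i \<Rightarrow> 'g)) rl set) =
    variety_generated_by (finite_dim_kites :: (nat \<times> ('i \<Rightarrow> 'g)) rl set)"
proof -
  have "finite_dim_kites \<subseteq> (kites :: (nat \<times> ('i \<Rightarrow> 'g)) rl set)"
    by (auto simp: finite_dim_kites_def kites_def)
  then have "is_variety C \<and> kites \<subseteq> C \<longleftrightarrow> is_variety C \<and> finite_dim_kites \<subseteq> C"
    for C :: "(nat \<times> ('i \<Rightarrow> 'g)) rl set"
    using kites_subset_variety by blast
  then show ?thesis by (simp add: variety_generated_by_def)
qed

end
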